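(* Fix the initial weights $w_0$. For every $t \in \mathbb{N}$ (with $0\in\mathbb N$) and every square matrix $B \in \mathbb{R}^{p \times p}$, both $\operatorname{var}\left(B g_t^b \,\middle|\, \mathcal{F}_0 \right)$ and $\operatorname{var}\left(B\nabla L\left(w_t^b\right) \,\middle|\, \mathcal{F}_0 \right)$ are decreasing functions of the mini-batch size $b$ for $b \in \{1,\dots,n\}$.
   Context: Mini-batch SGD for linear regression. Data $(x_1,y_1),\dots,(x_n,y_n)$ with $x_i\in\mathbb{R}^p$, $y_i\in\mathbb{R}$, $n\ge 2$. For $w\in\mathbb{R}^p$ let $L_i(w)=\frac12 (w^\top x_i-y_i)^2$ and $L(w)=\frac1n\sum_{i=1}^n L_i(w)$. Fix initial weights $w_0\in\mathbb{R}^p$ and learning rates $\alpha_t>0$, both independent of $b$. For mini-batch size $b\in[n]=\{1,\dots,n\}$, set $w_0^b=w_0$ and, for each $t\ge0$, sample $\mathcal{B}_t^b$ uniformly at random among subsets of $[n]$ of cardinality $b$, independently over iterations, and set $w_{t+1}^b=w_t^b-\alpha_t g_t^b$, where $g_t^b=\frac1b\sum_{i\in\mathcal{B}_t^b}\nabla L_i(w_t^b)$ is the stochastic gradient. $\mathcal{F}_0$ is the information consisting of $w_0$ only, so conditioning on $\mathcal{F}_0$ means that $w_0$ is fixed and the randomness comes from the mini-batches. For a random vector $Z$, $\operatorname{var}(Z\mid\mathcal{F}_0)=\mathbb{E}[\|Z\|^2\mid\mathcal{F}_0]-\|\mathbb{E}[Z\mid\mathcal{F}_0]\|^2$, a scalar,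 with $\|\cdot\|$ the Euclidean norm. "Decreasing" is in the non-strict sense (non-increasing). *)

theory Defs
  imports "HOL-Probability.Probability"
begin

definition gradient :: "('a::real_inner \<Rightarrow> real) \<Rightarrow> 'a \<Rightarrow> 'a" where
  "gradient f w = (THE D. GDERIV f w :> D)"

definition sample_loss ::
    "(nat \<Rightarrow> real ^ 'p) \<Rightarrow> (nat \<Rightarrow> real) \<Rightarrow> nat \<Rightarrow> real ^ 'p \<Rightarrow> real" where
  "sample_loss x y i w = 1 / 2 * (w \<bullet> x i - y i)\<^sup>2"

definition full_loss ::
    "nat \<Rightarrow> (nat \<Rightarrow> real ^ 'p) \<Rightarrow> (nat \<Rightarrow> real) \<Rightarrow> real ^ 'p \<Rightarrow> real" where
  "full_loss n x y w = 1 / real n * (\<Sum>i = 1..n. sample_loss x y i w)"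

definition batches :: "nat \<Rightarrow> nat \<Rightarrow> nat set set" where
  "batches n b = {A. A \<subseteq> {1..n} \<and> card A = b}"

definition batch_grad ::
    "(nat \<Rightarrow> real ^ 'p) \<Rightarrow> (nat \<Rightarrow> real) \<Rightarrow> nat \<Rightarrow> nat set \<Rightarrow> real ^ 'p \<Rightarrow> real ^ 'p" where
  "batch_grad x y b A w = (1 / real b) *\<^sub>R (\<Sum>i\<in>A. gradient (sample_loss x y i) w)"

text \<open>The argument \<open>\<B>\<close> of the next two functions is one realisation of the sequence of
  mini-batches; the random iterates are obtained by inserting \<open>\<lambda>t. S b t \<omega>\<close> for it.\<close>

primrec sgd_weights ::
    "(nat \<Rightarrow> real ^ 'p) \<Rightarrow> (nat \<Rightarrow> real) \<Rightarrow> (nat \<Rightarrow> real) \<Rightarrow> real ^ 'p \<Rightarrow> nat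
      \<Rightarrow> (nat \<Rightarrow> nat set) \<Rightarrow> nat \<Rightarrow> real ^ 'p" where
  "sgd_weights x y \<alpha> w0 b \<B> 0 = w0"
| "sgd_weights x y \<alpha> w0 b \<B> (Suc t) =
     sgd_weights x y \<alpha> w0 b \<B> t
       - \<alpha> t *\<^sub>R batch_grad x y b (\<B> t) (sgd_weights x y \<alpha> w0 b \<B> t)"

definition sgd_grad ::
    "(nat \<Rightarrow> real ^ 'p) \<Rightarrow> (nat \<Rightarrow> real) \<Rightarrow> (nat \<Rightarrow> real) \<Rightarrow> real ^ 'p \<Rightarrow> nat
      \<Rightarrow> (nat \<Rightarrow> nat set) \<Rightarrow> nat \<Rightarrow> real ^ 'p" where
  "sgd_grad x y \<alpha> w0 b \<B> t = batch_grad x y b (\<B> t) (sgd_weights x y \<alpha> w0 b \<B> t)"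

text \<open>Uniform sampling of a mini-batch of size \<open>b\<close> from \<open>{1..n}\<close> in every iteration,
  independently over the iterations. Measurability of each \<open>S t\<close> is part of
  \<^const>\<open>prob_space.indep_vars\<close>.\<close>

definition minibatch_sampling ::
    "'a measure \<Rightarrow> nat \<Rightarrow> nat \<Rightarrow> (nat \<Rightarrow> 'a \<Rightarrow> nat set) \<Rightarrow> bool" where
  "minibatch_sampling M n b S \<longleftrightarrow>
     prob_space.indep_vars M (\<lambda>t. count_space (batches n b)) S UNIV \<and>
     (\<forall>t. distr M (count_space (batches n b)) (S t) = uniform_count_measure (batches n b))"

text \<open>The initial weights are deterministic, so conditioning on them is conditioning on a trivial
  sigma-algebra, and the conditional variance is given by plain expectations.\<close>

definition vec_variance :: "'a measure \<Rightarrow> ('a \<Rightarrow> real ^ 'p) \<Rightarrow> real" where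
  "vec_variance M Z = (\<integral>\<omega>. (norm (Z \<omega>))\<^sup>2 \<partial>M) - (norm (\<integral>\<omega>. Z \<omega> \<partial>M))\<^sup>2"

end

theory Submission
  imports Defs
begin

text \<open>Since every \<open>\<nabla>L\<^sub>i\<close> is affine and sampling is unbiased, the expectation of an affine functional
  of \<open>w\<^sub>t\<close> does not depend on \<open>b\<close>, so only second moments matter. Sampling without replacement gives,
  for every \<open>f\<close> and every \<open>u\<close>,
  \[ E (f(w_t) + u \cdot g_t)^2 = E (f(w_t) + u \cdot \nabla L(w_t))^2
     + \frac{n - b}{b (n - 1)} \cdot \frac 1 n \sum_i E (u \cdot (\nabla L_i - \nabla L)(w_t))^2. \]
  If \<open>f\<close> is affine, every square on the right is the square of an affine functional of \<open>w\<^sub>t\<close>, and the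
  factor is nonnegative and decreasing in \<open>b\<close>. As \<open>f(w\<^sub>t\<^sub>+\<^sub>1)\<close> has the form \<open>f(w\<^sub>t) + u \<cdot> g\<^sub>t\<close>, induction
  on \<open>t\<close> shows that the second moment of every affine functional of \<open>w\<^sub>t\<close> is decreasing in \<open>b\<close>; the two
  variances are sums of such moments over the rows of \<open>B\<close>.\<close>

section \<open>Counting the mini-batches that contain given indices\<close>

lemma finite_batches [simp]: "finite (batches n b)"
  unfolding batches_def by simp

lemma batch_subset: "A \<in> batches n b \<Longrightarrow> A \<subseteq> {1..n}"
  by (simp add: batches_def)

lemma card_batches: "card (batches n b) = n choose b"
  unfolding batches_def using n_subsets[of "{1..n}" b] by simp

lemma card_batches_pos: "b \<le> n \<Longrightarrow> 0 < card (batches n b)"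
  by (simp add: card_batches)

text \<open>Deleting \<open>J\<close> is a bijection onto the subsets of \<open>{1..n} - J\<close>
  of size \<open>b - card J\<close>, with \<open>C \<union> J\<close> as its inverse.\<close>

lemma card_batches_containing:
  assumes "J \<subseteq> {1..n}" "card J \<le> b"
  shows "card {A \<in> batches n b. J \<subseteq> A} = (n - card J) choose (b - card J)"
proof -
  have fin: "finite J" using assms(1) finite_subset by auto
  have "bij_betw (\<lambda>C. C \<union> J) {C. C \<subseteq> {1..n} - J \<and> card C = b - card J} {A \<in> batches n b. J \<subseteq> A}"
  proof (rule bij_betw_byWitness[where f' = "\<lambda>A. A - J"])
    show "(\<lambda>C. C \<union> J) ` {C. C \<subseteq> {1..n} - J \<and> card C = b - card J} \<subseteq> {A \<in> batches n b. J \<subseteq> A}"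
    proof safe
      fix C assume C: "C \<subseteq> {1..n} - J" "card C = b - card J"
      then have "finite C" "C \<inter> J = {}" using finite_subset by auto
      then show "C \<union> J \<in> batches n b"
        using C assms fin by (auto simp: batches_def card_Un_disjoint)
    qed
    show "(\<lambda>A. A - J) ` {A \<in> batches n b. J \<subseteq> A} \<subseteq> {C. C \<subseteq> {1..n} - J \<and> card C = b - card J}"
      using fin by (auto simp: batches_def card_Diff_subset)
  qed auto
  then have "card {A \<in> batches n b. J \<subseteq> A} = card {C. C \<subseteq> {1..n} - J \<and> card C = b - card J}"
    by (simp add: bij_betw_same_card)
  also have "\<dots> = (n - card J) choose (b - card J)"
    using n_subsets[of "{1..n} - J"] fin assms(1) by (simp add: card_Diff_subset)
  finally show ?thesis .
qed

text \<open>The inclusion probability b/n of one index in a uniform batch, cleared of denominators;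
  it follows from the absorption identity for binomial coefficients.\<close>

lemma card_batches_element:
  assumes "i \<in> {1..n}" "1 \<le> b"
  shows "real n * card {A \<in> batches n b. i \<in> A} = real b * card (batches n b)"
proof -
  have "card {A \<in> batches n b. i \<in> A} = (n - 1) choose (b - 1)"
    using card_batches_containing[of "{i}" n b] assms by simp
  moreover have "n * ((n - 1) choose (b - 1)) = b * (n choose b)"
    using times_binomial_minus1_eq[of b n] assms by simp
  ultimately show ?thesis
    by (metis card_batches of_nat_mult)
qed

text \<open>The joint inclusion probability b(b-1)/(n(n-1)) of two distinct indices, cleared of
  denominators; absorption is applied twice.\<close>

lemma card_batches_pair:
  assumes "i \<in> {1..n}" "j \<in> {1..n}" "i \<noteq> j" "1 \<le> b"
  shows "real n * (real n - 1) * card {A \<in> batches n b. i \<in> A \<and> j \<in> A}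
    = real b * (real b - 1) * card (batches n b)"
proof (cases "b = 1")
  case True
  \<comment> \<open>A singleton batch holds no pair. The case is separate because truncated
    subtraction would turn \<open>(n - 2) choose (b - 2)\<close> into 1.\<close>
  then have "{A \<in> batches n b. i \<in> A \<and> j \<in> A} = {}"
    using assms by (auto simp: batches_def card_1_singleton_iff)
  with True show ?thesis by simp
next
  case False
  with assms have b: "2 \<le> b" by simp
  have n: "1 \<le> n" using assms by auto
  have "card {A \<in> batches n b. i \<in> A \<and> j \<in> A} = (n - 2) choose (b - 2)"
    using card_batches_containing[of "{i, j}" n b] assms b by (simp add: numeral_2_eq_2)
  moreover have "n * ((n - 1) choose (b - 1)) = b * (n choose b)"
    using times_binomial_minus1_eq[of b n] b by simp
  moreover have "(n - 1) * ((n - 2) choose (b - 2)) = (b - 1) * ((n - 1) choose (b - 1))"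
    using times_binomial_minus1_eq[of "b - 1" "n - 1"] b by (simp add: numeral_2_eq_2)
  ultimately have "n * (n - 1) * card {A \<in> batches n b. i \<in> A \<and> j \<in> A}
      = b * (b - 1) * card (batches n b)"
    by (metis (no_types, lifting) card_batches mult.assoc mult.left_commute)
  then have "real (n * (n - 1) * card {A \<in> batches n b. i \<in> A \<and> j \<in> A})
      = real (b * (b - 1) * card (batches n b))"
    by (rule arg_cong)
  then show ?thesis using b n by (simp add: of_nat_diff)
qed

section \<open>First and second moments of batch sums\<close>

text \<open>Moves the dependence on \<open>A\<close> from the range of summation into an indicator,
  so that sums over batches and over indices can be swapped.\<close>

lemma sum_over_batch:
  assumes "A \<in> batches n b"
  shows "(\<Sum>i\<in>A. d i) = (\<Sum>i=1..n. of_bool (i \<in> A) * (d i :: real))"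
proof -
  have "(\<Sum>i\<in>A. d i) = (\<Sum>i\<in>{1..n} \<inter> A. d i)"
    using batch_subset[OF assms] by (simp add: Int_absorb1)
  also have "\<dots> = (\<Sum>i=1..n. if i \<in> A then d i else 0)"
    by (simp add: sum.inter_restrict)
  also have "\<dots> = (\<Sum>i=1..n. of_bool (i \<in> A) * d i)"
    by (intro sum.cong refl) simp
  finally show ?thesis .
qed

lemma sum_of_bool_times_const:
  assumes "finite X"
  shows "(\<Sum>A\<in>X. of_bool (P A) * k) = real (card {A \<in> X. P A}) * k"
proof -
  have "X \<inter> {A. P A} = {A \<in> X. P A}" by auto
  with assms show ?thesis
    by (simp only: sum_distrib_right[symmetric] sum_of_bool_eq)
qed

text \<open>Double counting: every index lies in the same fraction b/n of the batches.\<close>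

lemma sum_batches_sum:
  assumes "1 \<le> b"
  shows "real n * (\<Sum>A\<in>batches n b. \<Sum>i\<in>A. d i)
    = real b * card (batches n b) * (\<Sum>i=1..n. (d i :: real))"
proof -
  have "(\<Sum>A\<in>batches n b. \<Sum>i\<in>A. d i)
      = (\<Sum>A\<in>batches n b. \<Sum>i=1..n. of_bool (i \<in> A) * d i)"
    by (intro sum.cong refl sum_over_batch)
  also have "\<dots> = (\<Sum>i=1..n. card {A \<in> batches n b. i \<in> A} * d i)"
    by (subst sum.swap) (simp only: sum_of_bool_times_const[OF finite_batches])
  finally have "real n * (\<Sum>A\<in>batches n b. \<Sum>i\<in>A. d i)
      = (\<Sum>i=1..n. real n * card {A \<in> batches n b. i \<in> A} * d i)"
    by (simp add: sum_distrib_left mult.assoc)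
  also have "\<dots> = (\<Sum>i=1..n. real b * card (batches n b) * d i)"
    using assms by (intro sum.cong refl) (simp add: card_batches_element)
  finally show ?thesis by (simp add: sum_distrib_left)
qed

text \<open>Expanding the square weights each product \<open>d i * d j\<close> by the number of
  batches containing both indices. That number takes one value on the diagonal and one off it, and
  centring removes the part common to all pairs.\<close>

lemma sum_batches_sum_square_centred:
  assumes "1 \<le> b" and centred: "(\<Sum>i=1..n. d i) = 0"
  shows "real n * (real n - 1) * (\<Sum>A\<in>batches n b. (\<Sum>i\<in>A. d i)\<^sup>2)
    = real b * (real n - real b) * card (batches n b) * (\<Sum>i=1..n. (d i :: real)\<^sup>2)"
proof -
  let ?N = "real (card (batches n b))"
  let ?c = "\<lambda>i j. real (card {A \<in> batches n b. i \<in> A \<and> j \<in> A})"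
  have double_sum: "(\<Sum>i=1..n. \<Sum>j=1..n. k * (d i * d j)) = k * (\<Sum>i=1..n. d i)\<^sup>2" for k
    unfolding power2_eq_square sum_product by (simp only: sum_distrib_left)
  have "(\<Sum>A\<in>batches n b. (\<Sum>i\<in>A. d i)\<^sup>2)
      = (\<Sum>A\<in>batches n b. (\<Sum>i=1..n. of_bool (i \<in> A) * d i)\<^sup>2)"
    by (intro sum.cong refl arg_cong[where f = power2] sum_over_batch)
  also have "\<dots> = (\<Sum>A\<in>batches n b. \<Sum>i=1..n. \<Sum>j=1..n. of_bool (i \<in> A \<and> j \<in> A) * (d i * d j))"
    unfolding power2_eq_square sum_product of_bool_conj
    by (intro sum.cong refl) (simp only: mult_ac)
  also have "\<dots> = (\<Sum>i=1..n. \<Sum>j=1..n. \<Sum>A\<in>batches n b. of_bool (i \<in> A \<and> j \<in> A) * (d i * d j))"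
    by (subst sum.swap, rule sum.cong[OF refl], subst sum.swap, rule refl)
  also have "\<dots> = (\<Sum>i=1..n. \<Sum>j=1..n. ?c i j * (d i * d j))"
    by (simp only: sum_of_bool_times_const[OF finite_batches])
  finally have "real n * (real n - 1) * (\<Sum>A\<in>batches n b. (\<Sum>i\<in>A. d i)\<^sup>2)
      = (\<Sum>i=1..n. \<Sum>j=1..n. real n * (real n - 1) * ?c i j * (d i * d j))"
    by (simp add: sum_distrib_left mult.assoc)
  \<comment> \<open>The off-diagonal weight is extended to all pairs; the diagonal then lacks b(n-1)
    - b(b-1) = b(n-b) times the number of batches.\<close>
  also have "\<dots> = (\<Sum>i=1..n. \<Sum>j=1..n. real b * (real b - 1) * ?N * (d i * d j)
      + (if i = j then real b * (real n - real b) * ?N * (d i)\<^sup>2 else 0))"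
  proof (intro sum.cong refl)
    fix i j assume ij: "i \<in> {1..n}" "j \<in> {1..n}"
    show "real n * (real n - 1) * ?c i j * (d i * d j) = real b * (real b - 1) * ?N * (d i * d j)
      + (if i = j then real b * (real n - real b) * ?N * (d i)\<^sup>2 else 0)"
    proof (cases "i = j")
      case True
      have "real n * (real n - 1) * ?c i j = (real n - 1) * (real b * ?N)"
        using card_batches_element[OF ij(1) assms(1)] True by (simp add: mult_ac)
      then have *: "real n * (real n - 1) * ?c i j
          = real b * (real b - 1) * ?N + real b * (real n - real b) * ?N"
        by (simp add: algebra_simps)
      show ?thesis unfolding * using True by (simp add: power2_eq_square distrib_right)
    next
      case False
      then show ?thesis using card_batches_pair[OF ij False assms(1)] by simp
    qed
  qed
  also have "\<dots> = real b * (real b - 1) * ?N * (\<Sum>i=1..n. d i)\<^sup>2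
      + real b * (real n - real b) * ?N * (\<Sum>i=1..n. (d i)\<^sup>2)"
    unfolding sum.distrib double_sum by (simp add: sum_distrib_left)
  finally show ?thesis using centred by simp
qed

text \<open>Unbiasedness of the batch mean. The offset \<open>a\<close> makes room for the value of
  a functional at the current weights.\<close>

lemma batch_mean_average:
  assumes "b \<in> {1..n}"
  shows "(\<Sum>A\<in>batches n b. a + (\<Sum>i\<in>A. z i) / real b) / card (batches n b)
    = a + (\<Sum>i=1..n. (z i :: real)) / n"
proof -
  have b: "0 < b" "0 < n" "1 \<le> b" "b \<le> n" using assms by auto
  have N: "0 < real (card (batches n b))" using card_batches_pos[OF b(4)] by simp
  have ne: "batches n b \<noteq> {}" using card_batches_pos[OF b(4)] by auto
  have "(\<Sum>A\<in>batches n b. \<Sum>i\<in>A. z i) = real b * card (batches n b) * (\<Sum>i=1..n. z i) / n"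
    using sum_batches_sum[OF b(3), of n z] b(2) by (simp add: field_simps)
  then show ?thesis
    using b N ne by (simp add: sum.distrib sum_divide_distrib[symmetric] add_divide_distrib)
qed

text \<open>With \<open>z\<close> centred at \<open>m\<close>, the batch mean is \<open>m\<close>
  plus the mean deviation over the batch. The cross term averages to zero, and the squared deviation
  yields the population variance times the finite-population correction of sampling without
  replacement.\<close>

lemma batch_mean_square_average:
  fixes z :: "nat \<Rightarrow> real"
  assumes "2 \<le> n" "b \<in> {1..n}"
  defines "m \<equiv> (\<Sum>i=1..n. z i) / n"
  shows "(\<Sum>A\<in>batches n b. (a + (\<Sum>i\<in>A. z i) / real b)\<^sup>2) / card (batches n b)
    = (a + m)\<^sup>2
      + (real n - real b) / (real b * (real n - 1)) * ((\<Sum>i=1..n. (z i - m)\<^sup>2) / n)"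
proof -
  define d where "d i = z i - m" for i
  have b: "0 < b" "1 \<le> b" "b \<le> n" using assms(2) by auto
  have n: "0 < n" "real n - 1 > 0" using assms(1) by auto
  have ne: "batches n b \<noteq> {}" using card_batches_pos[OF b(3)] by auto
  have N: "0 < real (card (batches n b))" using card_batches_pos[OF b(3)] by simp
  have centred: "(\<Sum>i=1..n. d i) = 0"
    unfolding d_def using n by (simp add: sum_subtractf m_def)
  have first: "(\<Sum>A\<in>batches n b. \<Sum>i\<in>A. d i) = 0"
    using sum_batches_sum[OF b(2), of n d] centred n by simp
  have "(\<Sum>A\<in>batches n b. (a + (\<Sum>i\<in>A. z i) / real b)\<^sup>2)
      = (\<Sum>A\<in>batches n b. (a + m)\<^sup>2 + 2 * (a + m) / b * (\<Sum>i\<in>A. d i) + (\<Sum>i\<in>A. d i)\<^sup>2 / b\<^sup>2)"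
  proof (intro sum.cong refl)
    fix A assume "A \<in> batches n b"
    then have "(\<Sum>i\<in>A. d i) = (\<Sum>i\<in>A. z i) - b * m"
      by (simp add: d_def sum_subtractf batches_def)
    then have *: "a + (\<Sum>i\<in>A. z i) / b = (a + m) + (\<Sum>i\<in>A. d i) / b"
      using b by (simp add: field_simps)
    show "(a + (\<Sum>i\<in>A. z i) / b)\<^sup>2
        = (a + m)\<^sup>2 + 2 * (a + m) / b * (\<Sum>i\<in>A. d i) + (\<Sum>i\<in>A. d i)\<^sup>2 / b\<^sup>2"
      unfolding * by (simp add: power2_sum power_divide)
  qed
  also have "\<dots> = card (batches n b) * (a + m)\<^sup>2 + (\<Sum>A\<in>batches n b. (\<Sum>i\<in>A. d i)\<^sup>2) / b\<^sup>2"
    by (simp add: sum.distrib sum_distrib_left[symmetric] sum_divide_distrib[symmetric] first)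
  also have "(\<Sum>A\<in>batches n b. (\<Sum>i\<in>A. d i)\<^sup>2)
      = real b * (real n - real b) * card (batches n b) * (\<Sum>i=1..n. (d i)\<^sup>2) / (real n * (real n - 1))"
    using sum_batches_sum_square_centred[OF b(2) centred] n by (simp add: field_simps)
  finally show ?thesis
    using b n N ne by (simp add: d_def[symmetric] add_divide_distrib power2_eq_square)
qed

section \<open>Gradients of the losses\<close>

text \<open>The derivative is unique, and a vector is determined by its inner products with all
  vectors, so the \<open>THE\<close> in \<open>gradient\<close> denotes \<open>D\<close>.\<close>

lemma gradient_eqI:
  assumes "GDERIV f w :> D"
  shows "gradient f w = D"
  unfolding gradient_def
proof (rule the_equality)
  show "GDERIV f w :> D" by (rule assms)
next
  fix E assume "GDERIV f w :> E"
  then have "(\<lambda>h. inner h E) = (\<lambda>h. inner h D)"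
    using assms unfolding gderiv_def by (rule has_derivative_unique)
  then show "E = D"
    by (metis inner_commute vector_eq_ldot)
qed

lemma GDERIV_sample_loss: "GDERIV (sample_loss x y i) w :> (w \<bullet> x i - y i) *\<^sub>R x i"
  unfolding gderiv_def sample_loss_def
  by (auto intro!: derivative_eq_intros simp: fun_eq_iff inner_commute)

lemma gradient_sample_loss: "gradient (sample_loss x y i) w = (w \<bullet> x i - y i) *\<^sub>R x i"
  by (rule gradient_eqI[OF GDERIV_sample_loss])

lemma gradient_full_loss:
  "gradient (full_loss n x y) w = (1 / real n) *\<^sub>R (\<Sum>i=1..n. gradient (sample_loss x y i) w)"
proof (rule gradient_eqI)
  have "FDERIV (full_loss n x y) w
      :> (\<lambda>h. 1 / real n * (\<Sum>i=1..n. inner h ((w \<bullet> x i - y i) *\<^sub>R x i)))"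
    unfolding full_loss_def
    by (intro has_derivative_mult_right has_derivative_sum GDERIV_sample_loss[unfolded gderiv_def])
  then show "GDERIV (full_loss n x y) w
      :> (1 / real n) *\<^sub>R (\<Sum>i=1..n. gradient (sample_loss x y i) w)"
    unfolding gderiv_def by (simp add: gradient_sample_loss inner_sum_right)
qed

section \<open>Affine functionals of the weights\<close>

text \<open>The test functions of the inductions over \<open>t\<close>: adding
  \<open>u \<bullet> gradient (full_loss n x y) w\<close> to such a function stays in the
  class.\<close>

definition affine_functional :: "('a::real_inner \<Rightarrow> real) \<Rightarrow> bool" where
  "affine_functional f \<longleftrightarrow> (\<exists>v c. \<forall>w. f w = v \<bullet> w + c)"

lemma affine_functional_inner: "affine_functional (\<lambda>w. v \<bullet> w)"
  unfolding affine_functional_def by (rule exI[of _ v], rule exI[of _ 0]) simp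

lemma affine_functional_const: "affine_functional (\<lambda>w. c)"
  unfolding affine_functional_def by (rule exI[of _ 0], rule exI[of _ c]) simp

lemma affine_functional_add:
  assumes "affine_functional f" "affine_functional g"
  shows "affine_functional (\<lambda>w. f w + g w)"
proof -
  from assms obtain u c v d where "\<forall>w. f w = u \<bullet> w + c" "\<forall>w. g w = v \<bullet> w + d"
    unfolding affine_functional_def by blast
  then show ?thesis
    unfolding affine_functional_def
    by (intro exI[of _ "u + v"] exI[of _ "c + d"]) (simp add: inner_add_left)
qed

lemma affine_functional_scale:
  assumes "affine_functional f"
  shows "affine_functional (\<lambda>w. k * f w)"
proof -
  from assms obtain u c where "\<forall>w. f w = u \<bullet> w + c"
    unfolding affine_functional_def by blast
  then show ?thesis
    unfolding affine_functional_def
    by (intro exI[of _ "k *\<^sub>R u"] exI[of _ "k * c"]) (simp add: distrib_left)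
qed

lemma affine_functional_diff:
  assumes "affine_functional f" "affine_functional g"
  shows "affine_functional (\<lambda>w. f w - g w)"
  using affine_functional_add[OF assms(1) affine_functional_scale[OF assms(2), of "- 1"]] by simp

lemma affine_functional_sum:
  assumes "\<And>i. i \<in> I \<Longrightarrow> affine_functional (f i)"
  shows "affine_functional (\<lambda>w. \<Sum>i\<in>I. f i w)"
  using assms
  by (induction I rule: infinite_finite_induct)
    (auto intro: affine_functional_const affine_functional_add)

text \<open>This is where the squared loss of a linear model matters: its gradient is affine in the
  weights.\<close>

lemma affine_functional_gradient_sample_loss:
  "affine_functional (\<lambda>w. u \<bullet> gradient (sample_loss x y i) w)"
proof -
  have "affine_functional (\<lambda>w. (u \<bullet> x i) * (x i \<bullet> w - y i))"
    by (intro affine_functional_scale affine_functional_diff affine_functional_inner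
        affine_functional_const)
  then show ?thesis
    by (simp add: gradient_sample_loss inner_commute mult.commute)
qed

lemma affine_functional_gradient_full_loss:
  "affine_functional (\<lambda>w. u \<bullet> gradient (full_loss n x y) w)"
  unfolding gradient_full_loss inner_scaleR_right inner_sum_right
  by (intro affine_functional_scale affine_functional_sum affine_functional_gradient_sample_loss)

section \<open>Dependence on past batches, and variance by coordinates\<close>

text \<open>Only batches strictly before \<open>t\<close> enter the weights at time
  \<open>t\<close>; this gives the independence from the batch drawn at \<open>t\<close>.\<close>

lemma sgd_weights_cong:
  "(\<And>s. s < t \<Longrightarrow> \<B> s = \<C> s) \<Longrightarrow> sgd_weights x y \<alpha> w0 b \<B> t = sgd_weights x y \<alpha> w0 b \<C> t"
  by (induction t) simp_all


text \<open>The squared norm is a sum of squared coordinates and the integral commutes with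
  coordinate projections, so scalar first and second moments suffice.\<close>

lemma vec_variance_components:
  fixes Z :: "'a \<Rightarrow> real ^ 'p"
  assumes "integrable M Z" and "\<And>k. integrable M (\<lambda>\<omega>. (Z \<omega> $ k)\<^sup>2)"
  shows "vec_variance M Z
    = (\<Sum>k\<in>UNIV. (\<integral>\<omega>. (Z \<omega> $ k)\<^sup>2 \<partial>M) - (\<integral>\<omega>. Z \<omega> $ k \<partial>M)\<^sup>2)"
proof -
  have norm2: "(norm v)\<^sup>2 = (\<Sum>k\<in>UNIV. (v $ k)\<^sup>2)" for v :: "real ^ 'p"
    unfolding power2_norm_eq_inner inner_vec_def by (simp add: power2_eq_square)
  have "(\<integral>\<omega>. Z \<omega> \<partial>M) $ k = (\<integral>\<omega>. Z \<omega> $ k \<partial>M)" for k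
    using integral_bounded_linear[OF bounded_linear_vec_nth assms(1)] by simp
  then show ?thesis
    using assms(2) by (simp add: vec_variance_def norm2 sum_subtractf)
qed

section \<open>One SGD run with a fixed batch size\<close>

text \<open>\<open>T\<close> stands for the batch sequence \<open>S b\<close> of the theorem at a
  single \<open>b\<close>.\<close>

locale minibatch_sgd = prob_space M for M :: "'a measure" +
  fixes n :: nat and x :: "nat \<Rightarrow> real ^ 'p" and y :: "nat \<Rightarrow> real"
    and \<alpha> :: "nat \<Rightarrow> real" and w0 :: "real ^ 'p" and b :: nat and T :: "nat \<Rightarrow> 'a \<Rightarrow> nat set"
  assumes batch_size: "b \<in> {1..n}" and sampling: "minibatch_sampling M n b T"
begin

abbreviation weights :: "nat \<Rightarrow> 'a \<Rightarrow> real ^ 'p" where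
  "weights t \<omega> \<equiv> sgd_weights x y \<alpha> w0 b (\<lambda>s. T s \<omega>) t"

abbreviation stoch_grad :: "nat \<Rightarrow> 'a \<Rightarrow> real ^ 'p" where
  "stoch_grad t \<omega> \<equiv> sgd_grad x y \<alpha> w0 b (\<lambda>s. T s \<omega>) t"

lemma indep_batches: "indep_vars (\<lambda>t. count_space (batches n b)) T UNIV"
  using sampling by (simp add: minibatch_sampling_def)

lemma measurable_batch [measurable]: "T t \<in> measurable M (count_space (batches n b))"
  using indep_batches by (simp add: indep_vars_def)

lemma prob_batch:
  assumes "A \<in> batches n b"
  shows "expectation (\<lambda>\<omega>. of_bool (T t \<omega> = A)) = 1 / card (batches n b)"
proof -
  have "expectation (\<lambda>\<omega>. of_bool (T t \<omega> = A))
      = (\<integral>C. (of_bool (C = A) :: real) \<partial>distr M (count_space (batches n b)) (T t))"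
    by (subst integral_distr) simp_all
  also have "\<dots> = (\<Sum>C\<in>batches n b. of_bool (C = A)) / card (batches n b)"
    using sampling by (simp add: minibatch_sampling_def integral_uniform_count_measure)
  also have "(\<Sum>C\<in>batches n b. of_bool (C = A)) = (1 :: real)"
    using assms by (simp add: of_bool_def)
  finally show ?thesis .
qed

text \<open>Turns finite histories into elements of a discrete space, on which every function is
  measurable.\<close>

lemma PiM_batches:
  "finite K \<Longrightarrow> PiM K (\<lambda>_. count_space (batches n b)) = count_space (PiE K (\<lambda>_. batches n b))"
  by (rule count_space_PiM_finite) (auto intro: countable_finite)

text \<open>A finite history takes finitely many values, so any function of it is bounded, here by
  the sum of the norms of all its values.\<close>

lemma integrable_history:
  fixes h :: "(nat \<Rightarrow> nat set) \<Rightarrow> 'c::{banach, second_countable_topology}"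
  assumes "finite K"
  shows "integrable M (\<lambda>\<omega>. h (\<lambda>s\<in>K. T s \<omega>))"
proof -
  let ?P = "PiE K (\<lambda>_. batches n b)"
  have fin: "finite ?P" using assms by (simp add: finite_PiE)
  have X: "(\<lambda>\<omega>. \<lambda>s\<in>K. T s \<omega>) \<in> measurable M (count_space ?P)"
    unfolding PiM_batches[OF assms, symmetric] by measurable
  show ?thesis
  proof (rule integrable_const_bound[where B = "\<Sum>p\<in>?P. norm (h p)"])
    show "(\<lambda>\<omega>. h (\<lambda>s\<in>K. T s \<omega>)) \<in> borel_measurable M"
      by (rule measurable_compose[OF X]) simp
    show "AE \<omega> in M. norm (h (\<lambda>s\<in>K. T s \<omega>)) \<le> (\<Sum>p\<in>?P. norm (h p))"
    proof (rule AE_I2)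
      fix \<omega> assume "\<omega> \<in> space M"
      then have "(\<lambda>s\<in>K. T s \<omega>) \<in> ?P"
        using measurable_space[OF X] by simp
      then show "norm (h (\<lambda>s\<in>K. T s \<omega>)) \<le> (\<Sum>p\<in>?P. norm (h p))"
        using fin by (intro member_le_sum) auto
    qed
  qed
qed

lemma integrable_step [simp]:
  fixes \<phi> :: "nat set \<Rightarrow> real ^ 'p \<Rightarrow> 'c::{banach, second_countable_topology}"
  shows "integrable M (\<lambda>\<omega>. \<phi> (T t \<omega>) (weights t \<omega>))"
proof -
  \<comment> \<open>The weights need only the batches in \<open>{..<t}\<close>, but
    \<open>\<phi>\<close> also sees \<open>T t\<close>, hence the history up to and including
    \<open>t\<close>.\<close>
  have "weights t \<omega> = sgd_weights x y \<alpha> w0 b (\<lambda>s\<in>{..t}. T s \<omega>) t" for \<omega>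
    by (rule sgd_weights_cong) simp
  then show ?thesis
    using integrable_history[of "{..t}" "\<lambda>f. \<phi> (f t) (sgd_weights x y \<alpha> w0 b f t)"]
    by simp
qed

lemma integrable_weights [simp]:
  fixes h :: "real ^ 'p \<Rightarrow> 'c::{banach, second_countable_topology}"
  shows "integrable M (\<lambda>\<omega>. h (weights t \<omega>))"
  by (rule integrable_step)

lemma integrable_stoch_grad [simp]:
  fixes h :: "real ^ 'p \<Rightarrow> 'c::{banach, second_countable_topology}"
  shows "integrable M (\<lambda>\<omega>. h (stoch_grad t \<omega>))"
  unfolding sgd_grad_def by (rule integrable_step)

text \<open>The current weights are a function of earlier batches, hence independent of
  \<open>T t\<close>, and each batch has probability \<open>1 / card (batches n b)\<close>.\<close>

lemma expectation_batch_indicator_times: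
  fixes h :: "real ^ 'p \<Rightarrow> real"
  assumes "A \<in> batches n b"
  shows "expectation (\<lambda>\<omega>. of_bool (T t \<omega> = A) * h (weights t \<omega>))
    = expectation (\<lambda>\<omega>. h (weights t \<omega>)) / card (batches n b)"
proof -
  let ?Y = "\<lambda>f :: nat \<Rightarrow> nat set. of_bool (f t = A) :: real"
  let ?Z = "\<lambda>f. h (sgd_weights x y \<alpha> w0 b f t)"
  let ?N = "\<lambda>_ :: nat. count_space (batches n b)"
  \<comment> \<open>Both variables are functions of restrictions of the batch sequence to disjoint
    index sets, \<open>{t}\<close> and \<open>{..<t}\<close>.\<close>
  have "indep_var borel (?Y \<circ> (\<lambda>\<omega>. \<lambda>s\<in>{t}. T s \<omega>)) borel (?Z \<circ> (\<lambda>\<omega>. \<lambda>s\<in>{..<t}. T s \<omega>))"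
  proof (rule indep_var_compose)
    show "indep_var (PiM {t} ?N) (\<lambda>\<omega>. \<lambda>s\<in>{t}. T s \<omega>) (PiM {..<t} ?N) (\<lambda>\<omega>. \<lambda>s\<in>{..<t}. T s \<omega>)"
      by (rule indep_var_restrict[OF indep_batches]) auto
  qed (simp_all add: PiM_batches)
  moreover have "?Z (\<lambda>s\<in>{..<t}. T s \<omega>) = h (weights t \<omega>)" for \<omega>
    by (rule arg_cong[where f = h], rule sgd_weights_cong) simp
  ultimately have "indep_var borel (\<lambda>\<omega>. of_bool (T t \<omega> = A) :: real) borel (\<lambda>\<omega>. h (weights t \<omega>))"
    by (simp add: comp_def)
  then have "expectation (\<lambda>\<omega>. of_bool (T t \<omega> = A) * h (weights t \<omega>))
      = expectation (\<lambda>\<omega>. of_bool (T t \<omega> = A)) * expectation (\<lambda>\<omega>. h (weights t \<omega>))"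
    by (rule indep_var_lebesgue_integral)
      (rule integrable_step[of "\<lambda>C _. of_bool (C = A)"], rule integrable_weights)
  then show ?thesis
    by (simp add: prob_batch[OF assms])
qed

text \<open>Conditioning on the current weights, made elementary: the integrand is split by the
  value of \<open>T t\<close>, and independence turns each indicator into a uniform weight.\<close>

lemma expectation_step:
  fixes \<phi> :: "nat set \<Rightarrow> real ^ 'p \<Rightarrow> real"
  shows "expectation (\<lambda>\<omega>. \<phi> (T t \<omega>) (weights t \<omega>))
    = expectation (\<lambda>\<omega>. (\<Sum>A\<in>batches n b. \<phi> A (weights t \<omega>)) / card (batches n b))"
proof -
  have "expectation (\<lambda>\<omega>. \<phi> (T t \<omega>) (weights t \<omega>))
      = expectation (\<lambda>\<omega>. \<Sum>A\<in>batches n b. of_bool (T t \<omega> = A) * \<phi> A (weights t \<omega>))"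
  proof (rule Bochner_Integration.integral_cong[OF refl])
    fix \<omega> assume "\<omega> \<in> space M"
    then have T: "T t \<omega> \<in> batches n b"
      using measurable_space[OF measurable_batch] by simp
    have "\<phi> (T t \<omega>) (weights t \<omega>)
        = (\<Sum>A\<in>{T t \<omega>}. of_bool (T t \<omega> = A) * \<phi> A (weights t \<omega>))"
      by simp
    also have "\<dots> = (\<Sum>A\<in>batches n b. of_bool (T t \<omega> = A) * \<phi> A (weights t \<omega>))"
      using T by (intro sum.mono_neutral_left) auto
    finally show "\<phi> (T t \<omega>) (weights t \<omega>)
        = (\<Sum>A\<in>batches n b. of_bool (T t \<omega> = A) * \<phi> A (weights t \<omega>))" .
  qed
  also have "\<dots> = (\<Sum>A\<in>batches n b. expectation (\<lambda>\<omega>. of_bool (T t \<omega> = A) * \<phi> A (weights t \<omega>)))"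
  proof (rule Bochner_Integration.integral_sum)
    show "integrable M (\<lambda>\<omega>. of_bool (T t \<omega> = A) * \<phi> A (weights t \<omega>))" for A
      using integrable_step[of "\<lambda>C w. of_bool (C = A) * \<phi> A w"] .
  qed
  also have "\<dots> = (\<Sum>A\<in>batches n b. expectation (\<lambda>\<omega>. \<phi> A (weights t \<omega>)) / card (batches n b))"
    by (intro sum.cong refl expectation_batch_indicator_times)
  also have "\<dots> = expectation (\<lambda>\<omega>. (\<Sum>A\<in>batches n b. \<phi> A (weights t \<omega>)) / card (batches n b))"
    by (simp add: sum_divide_distrib)
  finally show ?thesis .
qed

lemma inner_stoch_grad:
  "u \<bullet> stoch_grad t \<omega>
    = (\<Sum>i\<in>T t \<omega>. u \<bullet> gradient (sample_loss x y i) (weights t \<omega>)) / real b"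
  by (simp add: sgd_grad_def batch_grad_def inner_sum_right)

lemma inner_gradient_full_loss:
  "u \<bullet> gradient (full_loss n x y) w
    = (\<Sum>i=1..n. u \<bullet> gradient (sample_loss x y i) w) / real n"
  by (simp add: gradient_full_loss inner_sum_right)

text \<open>Puts a linear functional of the next weights into the form
  \<open>f (weights t \<omega>) + u \<bullet> stoch_grad t \<omega>\<close> that the moment formulas
  treat.\<close>

lemma inner_weights_Suc:
  "u \<bullet> weights (Suc t) \<omega> = u \<bullet> weights t \<omega> + (- \<alpha> t *\<^sub>R u) \<bullet> stoch_grad t \<omega>"
  by (simp add: sgd_grad_def inner_diff_right)

lemma expectation_affine_step:
  fixes f :: "real ^ 'p \<Rightarrow> real"
  shows "expectation (\<lambda>\<omega>. f (weights t \<omega>) + u \<bullet> stoch_grad t \<omega>)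
    = expectation (\<lambda>\<omega>. f (weights t \<omega>) + u \<bullet> gradient (full_loss n x y) (weights t \<omega>))"
  unfolding inner_stoch_grad inner_gradient_full_loss
    expectation_step[of "\<lambda>A w. f w + (\<Sum>i\<in>A. u \<bullet> gradient (sample_loss x y i) w) / real b"]
    batch_mean_average[OF batch_size] ..

text \<open>\<open>batch_mean_square_average\<close> is applied at each value of the current
  weights, with \<open>a = f w\<close>. The squares are integrated separately so that each can be
  compared across batch sizes.\<close>

lemma expectation_square_step:
  fixes f :: "real ^ 'p \<Rightarrow> real"
  assumes "2 \<le> n"
  shows "expectation (\<lambda>\<omega>. (f (weights t \<omega>) + u \<bullet> stoch_grad t \<omega>)\<^sup>2)
    = expectation (\<lambda>\<omega>. (f (weights t \<omega>) + u \<bullet> gradient (full_loss n x y) (weights t \<omega>))\<^sup>2)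
      + (real n - real b) / (real b * (real n - 1)) * ((\<Sum>i=1..n. expectation (\<lambda>\<omega>.
          (u \<bullet> gradient (sample_loss x y i) (weights t \<omega>)
            - u \<bullet> gradient (full_loss n x y) (weights t \<omega>))\<^sup>2)) / n)"
proof -
  let ?h = "\<lambda>i w. (u \<bullet> gradient (sample_loss x y i) w - u \<bullet> gradient (full_loss n x y) w)\<^sup>2"
  have int: "integrable M (\<lambda>\<omega>. ?h i (weights t \<omega>))" for i
    by (rule integrable_weights)
  have "expectation (\<lambda>\<omega>. (f (weights t \<omega>) + u \<bullet> stoch_grad t \<omega>)\<^sup>2)
    = expectation (\<lambda>\<omega>. (f (weights t \<omega>) + u \<bullet> gradient (full_loss n x y) (weights t \<omega>))\<^sup>2
      + (real n - real b) / (real b * (real n - 1)) * ((\<Sum>i=1..n. ?h i (weights t \<omega>)) / n))"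
    unfolding inner_stoch_grad inner_gradient_full_loss
      expectation_step[of "\<lambda>A w. (f w + (\<Sum>i\<in>A. u \<bullet> gradient (sample_loss x y i) w) / real b)\<^sup>2"]
      batch_mean_square_average[OF assms batch_size] ..
  also have "\<dots> = expectation (\<lambda>\<omega>. (f (weights t \<omega>) + u \<bullet> gradient (full_loss n x y) (weights t \<omega>))\<^sup>2)
      + expectation (\<lambda>\<omega>.
          (real n - real b) / (real b * (real n - 1)) * ((\<Sum>i=1..n. ?h i (weights t \<omega>)) / n))"
    by (rule Bochner_Integration.integral_add) (rule integrable_weights)+
  finally show ?thesis
    using int by (simp only: integral_mult_right_zero integral_divide_zero Bochner_Integration.integral_sum)
qed

text \<open>Coordinate \<open>k\<close> of a matrix-vector product is the inner product with row
  \<open>B $ k\<close>, which leads back to scalar functionals.\<close>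

lemma vec_variance_matrix_weights:
  fixes B :: "real ^ 'p ^ 'p" and h :: "real ^ 'p \<Rightarrow> real ^ 'p"
  shows "vec_variance M (\<lambda>\<omega>. B *v h (weights t \<omega>))
    = (\<Sum>k\<in>UNIV. expectation (\<lambda>\<omega>. (B $ k \<bullet> h (weights t \<omega>))\<^sup>2)
        - (expectation (\<lambda>\<omega>. B $ k \<bullet> h (weights t \<omega>)))\<^sup>2)"
  by (subst vec_variance_components, rule integrable_weights, rule integrable_weights)
    (simp add: matrix_vector_mul_component)

lemma vec_variance_matrix_stoch_grad:
  fixes B :: "real ^ 'p ^ 'p"
  shows "vec_variance M (\<lambda>\<omega>. B *v stoch_grad t \<omega>)
    = (\<Sum>k\<in>UNIV. expectation (\<lambda>\<omega>. (B $ k \<bullet> stoch_grad t \<omega>)\<^sup>2)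
        - (expectation (\<lambda>\<omega>. B $ k \<bullet> stoch_grad t \<omega>))\<^sup>2)"
  by (subst vec_variance_components, rule integrable_stoch_grad, rule integrable_stoch_grad)
    (simp add: matrix_vector_mul_component)

end

section \<open>Comparison of two batch sizes\<close>

text \<open>The runs share the data, learning rates and initial weights. Their joint law is left
  open, since each expectation compared involves one run only.\<close>

locale minibatch_sgd_pair =
  prob_space M + small: minibatch_sgd M n x y \<alpha> w0 b T + large: minibatch_sgd M n x y \<alpha> w0 b' T'
  for M :: "'a measure" and n :: nat and x :: "nat \<Rightarrow> real ^ 'p" and y \<alpha> w0 b T b' T' +
  assumes sample_size: "2 \<le> n" and batch_sizes: "b \<le> b'"
begin

text \<open>By unbiasedness, the mean of \<open>f\<close> after a step is the mean of another affine
  functional before it, and that functional is the same for both runs.\<close>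

lemma expectation_weights_eq:
  assumes "affine_functional f"
  shows "expectation (\<lambda>\<omega>. f (large.weights t \<omega>)) = expectation (\<lambda>\<omega>. f (small.weights t \<omega>))"
  using assms
proof (induction t arbitrary: f)
  case 0
  show ?case by simp
next
  case (Suc t)
  from Suc.prems obtain v c where f: "\<And>w. f w = v \<bullet> w + c"
    unfolding affine_functional_def by blast
  let ?u = "- \<alpha> t *\<^sub>R v"
  have f_step: "f (large.weights (Suc t) \<omega>) = f (large.weights t \<omega>) + ?u \<bullet> large.stoch_grad t \<omega>"
    "f (small.weights (Suc t) \<omega>) = f (small.weights t \<omega>) + ?u \<bullet> small.stoch_grad t \<omega>" for \<omega>
    unfolding f large.inner_weights_Suc small.inner_weights_Suc by simp_all
  show ?case
    unfolding f_step large.expectation_affine_step small.expectation_affine_step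
    by (rule Suc.IH) (intro affine_functional_add Suc.prems affine_functional_gradient_full_loss)
qed

text \<open>A larger batch shrinks the nonnegative numerator and enlarges the positive
  denominator.\<close>

lemma variance_factor_mono:
  "(real n - real b') / (real b' * (real n - 1)) \<le> (real n - real b) / (real b * (real n - 1))"
  using small.batch_size large.batch_size sample_size batch_sizes
  by (intro frac_le mult_right_mono mult_pos_pos) auto

text \<open>The second-moment identity is compared term by term: every square on its right is that
  of an affine functional. With \<open>mono\<close> as a hypothesis, the lemma serves both the
  induction step and the stochastic gradient itself.\<close>

lemma expectation_square_step_mono:
  fixes f :: "real ^ 'p \<Rightarrow> real"
  assumes f: "affine_functional f"
    and mono: "\<And>h. affine_functional h \<Longrightarrow> expectation (\<lambda>\<omega>. (h (large.weights t \<omega>))\<^sup>2)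
      \<le> expectation (\<lambda>\<omega>. (h (small.weights t \<omega>))\<^sup>2)"
  shows "expectation (\<lambda>\<omega>. (f (large.weights t \<omega>) + u \<bullet> large.stoch_grad t \<omega>)\<^sup>2)
    \<le> expectation (\<lambda>\<omega>. (f (small.weights t \<omega>) + u \<bullet> small.stoch_grad t \<omega>)\<^sup>2)"
  unfolding large.expectation_square_step[OF sample_size] small.expectation_square_step[OF sample_size]
proof (intro add_mono mult_mono variance_factor_mono divide_right_mono sum_mono mono)
  show "0 \<le> (real n - real b) / (real b * (real n - 1))"
    using small.batch_size sample_size by auto
qed (auto intro!: affine_functional_add affine_functional_diff f affine_functional_gradient_full_loss
    affine_functional_gradient_sample_loss sum_nonneg divide_nonneg_nonneg)

lemma expectation_weights_square_mono:
  assumes "affine_functional f"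
  shows "expectation (\<lambda>\<omega>. (f (large.weights t \<omega>))\<^sup>2)
    \<le> expectation (\<lambda>\<omega>. (f (small.weights t \<omega>))\<^sup>2)"
  using assms
proof (induction t arbitrary: f)
  case 0
  show ?case by simp
next
  case (Suc t)
  from Suc.prems obtain v c where f: "\<And>w. f w = v \<bullet> w + c"
    unfolding affine_functional_def by blast
  let ?u = "- \<alpha> t *\<^sub>R v"
  have f_step: "f (large.weights (Suc t) \<omega>) = f (large.weights t \<omega>) + ?u \<bullet> large.stoch_grad t \<omega>"
    "f (small.weights (Suc t) \<omega>) = f (small.weights t \<omega>) + ?u \<bullet> small.stoch_grad t \<omega>" for \<omega>
    unfolding f large.inner_weights_Suc small.inner_weights_Suc by simp_all
  show ?case
    unfolding f_step by (rule expectation_square_step_mono[OF Suc.prems Suc.IH])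
qed

text \<open>The means of both runs agree, so only second moments differ; the step lemmas with
  \<open>f = 0\<close> isolate the gradient term.\<close>

lemma vec_variance_stoch_grad_mono:
  fixes B :: "real ^ 'p ^ 'p"
  shows "vec_variance M (\<lambda>\<omega>. B *v large.stoch_grad t \<omega>) \<le> vec_variance M (\<lambda>\<omega>. B *v small.stoch_grad t \<omega>)"
proof -
  have "expectation (\<lambda>\<omega>. v \<bullet> large.stoch_grad t \<omega>)
      = expectation (\<lambda>\<omega>. v \<bullet> small.stoch_grad t \<omega>)" for v
    using large.expectation_affine_step[of "\<lambda>_. 0" t v] small.expectation_affine_step[of "\<lambda>_. 0" t v]
      expectation_weights_eq[OF affine_functional_gradient_full_loss[of v n x y], of t]
    by simp
  moreover have "expectation (\<lambda>\<omega>. (v \<bullet> large.stoch_grad t \<omega>)\<^sup>2)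
      \<le> expectation (\<lambda>\<omega>. (v \<bullet> small.stoch_grad t \<omega>)\<^sup>2)" for v
    using expectation_square_step_mono[OF affine_functional_const[of 0] expectation_weights_square_mono,
        where t = t and u = v]
    by simp
  ultimately show ?thesis
    unfolding large.vec_variance_matrix_stoch_grad small.vec_variance_matrix_stoch_grad
    by (simp add: sum_mono)
qed

text \<open>Each row of \<open>B\<close> gives an affine functional of the weights, with equal means
  in both runs and ordered second moments.\<close>

lemma vec_variance_full_gradient_mono:
  fixes B :: "real ^ 'p ^ 'p"
  shows "vec_variance M (\<lambda>\<omega>. B *v gradient (full_loss n x y) (large.weights t \<omega>))
    \<le> vec_variance M (\<lambda>\<omega>. B *v gradient (full_loss n x y) (small.weights t \<omega>))"
  unfolding large.vec_variance_matrix_weights small.vec_variance_matrix_weights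
    expectation_weights_eq[OF affine_functional_gradient_full_loss]
  by (intro sum_mono diff_right_mono expectation_weights_square_mono
      affine_functional_gradient_full_loss)

end

theorem theorem2:
  fixes M :: "'a measure"
    and n :: nat
    and x :: "nat \<Rightarrow> real ^ 'p"
    and y :: "nat \<Rightarrow> real"
    and \<alpha> :: "nat \<Rightarrow> real"
    and w0 :: "real ^ 'p"
    and S :: "nat \<Rightarrow> nat \<Rightarrow> 'a \<Rightarrow> nat set"
    and B :: "real ^ 'p ^ 'p"
    and t :: nat
  assumes "prob_space M"
    and "n \<ge> 2"
    and "\<And>s. \<alpha> s > 0"
    and "\<And>b. b \<in> {1..n} \<Longrightarrow> minibatch_sampling M n b (S b)"
  shows "antimono_on {1..n}
           (\<lambda>b. vec_variance M (\<lambda>\<omega>. B *v sgd_grad x y \<alpha> w0 b (\<lambda>s. S b s \<omega>) t))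
       \<and> antimono_on {1..n}
           (\<lambda>b. vec_variance M (\<lambda>\<omega>.
              B *v gradient (full_loss n x y) (sgd_weights x y \<alpha> w0 b (\<lambda>s. S b s \<omega>) t)))"
proof -
  have "minibatch_sgd_pair M n b (S b) b' (S b')"
    if "b \<in> {1..n}" "b' \<in> {1..n}" "b \<le> b'" for b b'
    using assms(1,2,4) that
    by (simp add: minibatch_sgd_pair_def minibatch_sgd_def minibatch_sgd_axioms_def
        minibatch_sgd_pair_axioms_def)
  then show ?thesis
    by (intro conjI monotone_onI minibatch_sgd_pair.vec_variance_stoch_grad_mono
        minibatch_sgd_pair.vec_variance_full_gradient_mono)
qed

end
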